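(* Let $C\subseteq\mathbb{R}^n$ be a perturbed cone and let $R$ be a cone region of $C$. Let $(M,g)$ be a complete connected Riemannian manifold and let $f:M\to\mathbb{R}^n$ be a proper harmonic map with $f(M)\subseteq R$. Then $f$ is constant.
   Context: $\mathbb{R}^n$ carries the standard flat metric. Harmonic map: a smooth map whose tension field $\mathrm{tr}_g\nabla df$ vanishes. Proper: preimages of compact sets (here, compact subsets of $\mathbb{R}^n$) are compact. A connected open set $R\subseteq\mathbb{R}^n$ possesses the enclosing property if for every $p\in R$ there is an affine hyperplane $H$ such that the connected component $B$ of $R\setminus H$ containing $p$ is precompact, i.e. $\overline{B}$ is compact. Let $C$ be a closed, path-connected subset of $\mathbb{R}^n$ such that $\mathbb{R}^n\setminus C$ consists of at least two connected components, and let $R$ be one of these connected components. If $R$ satisfies the enclosing property, then $C$ is called a perturbed cone and $R$ a cone region of $C$. *)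

theory Defs
  imports "HOL-Analysis.Analysis"
begin

section \<open>Smooth maps on open subsets of Euclidean space\<close>

fun Ck_on :: "nat \<Rightarrow> 'e::euclidean_space set \<Rightarrow> ('e \<Rightarrow> 'f::real_normed_vector) \<Rightarrow> bool" where
  "Ck_on 0 S F \<longleftrightarrow> continuous_on S F"
| "Ck_on (Suc k) S F \<longleftrightarrow>
     (\<forall>x\<in>S. F differentiable (at x)) \<and>
     (\<forall>v. Ck_on k S (\<lambda>x. frechet_derivative F (at x) v))"

definition smooth_on :: "'e::euclidean_space set \<Rightarrow> ('e \<Rightarrow> 'f::real_normed_vector) \<Rightarrow> bool" where
  "smooth_on S F \<longleftrightarrow> (\<forall>k. Ck_on k S F)"


section \<open>Smooth manifolds\<close>

text \<open>
  The points of a manifold form a type \<open>'a\<close>; a chart is a pair of its domain and its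
  coordinate map, whose values outside the domain are irrelevant.  The index type \<open>'m\<close> makes the
  manifold \<open>CARD('m)\<close>-dimensional.  Hausdorffness and second countability come from the
  type class of \<open>'a\<close>.
\<close>

type_synonym ('a, 'm) chart = "'a set \<times> ('a \<Rightarrow> real ^ 'm)"

abbreviation chart_inv :: "('a, 'm) chart \<Rightarrow> real ^ 'm \<Rightarrow> 'a" where
  "chart_inv c \<equiv> inv_into (fst c) (snd c)"

abbreviation transition :: "('a, 'm) chart \<Rightarrow> ('a, 'm) chart \<Rightarrow> real ^ 'm \<Rightarrow> real ^ 'm" where
  "transition c d \<equiv> snd d \<circ> chart_inv c"

definition smooth_atlas ::
  "('a::{t2_space,second_countable_topology}, 'm::finite) chart set \<Rightarrow> bool" where
  "smooth_atlas A \<longleftrightarrow>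
     (\<Union>c\<in>A. fst c) = UNIV \<and>
     (\<forall>c\<in>A. open (fst c) \<and> open (snd c ` fst c) \<and>
        homeomorphism (fst c) (snd c ` fst c) (snd c) (chart_inv c)) \<and>
     (\<forall>c\<in>A. \<forall>d\<in>A. smooth_on (snd c ` (fst c \<inter> fst d)) (transition c d))"

definition smooth_map ::
  "('a::{t2_space,second_countable_topology}, 'm::finite) chart set \<Rightarrow>
     ('a \<Rightarrow> real ^ 'n) \<Rightarrow> bool" where
  "smooth_map A f \<longleftrightarrow> (\<forall>c\<in>A. smooth_on (snd c ` fst c) (f \<circ> chart_inv c))"


section \<open>Riemannian metrics\<close>

text \<open>
  A Riemannian metric is given by its components: \<open>g c x\<close> is the Gram matrix of the
  coordinate frame of the chart \<open>c\<close> at the point with coordinates \<open>x\<close>.  The last clause is the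
  transformation law of a covariant 2-tensor, which makes the inner product on the tangent space
  independent of the chart.
\<close>

type_synonym ('a, 'm) metric_components =
  "('a, 'm) chart \<Rightarrow> real ^ 'm \<Rightarrow> real ^ 'm ^ 'm"

definition riemannian_metric ::
  "('a::{t2_space,second_countable_topology}, 'm::finite) chart set \<Rightarrow>
     ('a, 'm) metric_components \<Rightarrow> bool" where
  "riemannian_metric A g \<longleftrightarrow>
     (\<forall>c\<in>A. smooth_on (snd c ` fst c) (g c)) \<and>
     (\<forall>c\<in>A. \<forall>x\<in>snd c ` fst c.
        transpose (g c x) = g c x \<and> (\<forall>v. v \<noteq> 0 \<longrightarrow> v \<bullet> (g c x *v v) > 0)) \<and>
     (\<forall>c\<in>A. \<forall>d\<in>A. \<forall>x\<in>snd c ` (fst c \<inter> fst d).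
        let J = matrix (frechet_derivative (transition c d) (at x))
        in g c x = transpose J ** g d (transition c d x) ** J)"

definition riemannian_manifold ::
  "('a::{t2_space,second_countable_topology}, 'm::finite) chart set \<Rightarrow>
     ('a, 'm) metric_components \<Rightarrow> bool" where
  "riemannian_manifold A g \<longleftrightarrow> smooth_atlas A \<and> riemannian_metric A g"


section \<open>Riemannian distance and completeness\<close>

definition piecewise_C1_curve ::
  "('a::{t2_space,second_countable_topology}, 'm::finite) chart set \<Rightarrow> (real \<Rightarrow> 'a) \<Rightarrow> bool" where
  "piecewise_C1_curve A \<gamma> \<longleftrightarrow>
     continuous_on {0..1} \<gamma> \<and>
     (\<forall>c\<in>A. \<forall>a b. {a..b} \<subseteq> {0..1} \<and> \<gamma> ` {a..b} \<subseteq> fst c \<longrightarrow>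
        (snd c \<circ> \<gamma>) piecewise_C1_differentiable_on {a..b})"

text \<open>The norm of the velocity, computed in some chart; by the transformation law the choice
  does not matter wherever the curve is differentiable.\<close>

definition curve_speed ::
  "('a, 'm::finite) chart set \<Rightarrow> ('a, 'm) metric_components \<Rightarrow> (real \<Rightarrow> 'a) \<Rightarrow> real \<Rightarrow> real" where
  "curve_speed A g \<gamma> t =
     (let c = (SOME c. c \<in> A \<and> \<gamma> t \<in> fst c);
          v = vector_derivative (snd c \<circ> \<gamma>) (at t)
      in sqrt (v \<bullet> (g c (snd c (\<gamma> t)) *v v)))"

text \<open>The library's piecewise C1 curves may have unbounded velocity at a break point, so the
  length is taken in \<open>ennreal\<close>: a curve of infinite length gets length \<open>\<infinity>\<close>.\<close>

definition curve_length ::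
  "('a, 'm::finite) chart set \<Rightarrow> ('a, 'm) metric_components \<Rightarrow> (real \<Rightarrow> 'a) \<Rightarrow> ennreal" where
  "curve_length A g \<gamma> = (\<integral>\<^sup>+t\<in>{0..1}. ennreal (curve_speed A g \<gamma> t) \<partial>lborel)"

text \<open>Meant for connected manifolds, where the infimum is finite.\<close>

definition riemannian_dist ::
  "('a::{t2_space,second_countable_topology}, 'm::finite) chart set \<Rightarrow>
     ('a, 'm) metric_components \<Rightarrow> 'a \<Rightarrow> 'a \<Rightarrow> real" where
  "riemannian_dist A g p q =
     enn2real (INF \<gamma>\<in>{\<gamma>. piecewise_C1_curve A \<gamma> \<and> \<gamma> 0 = p \<and> \<gamma> 1 = q}. curve_length A g \<gamma>)"

definition complete_riemannian ::
  "('a::{t2_space,second_countable_topology}, 'm::finite) chart set \<Rightarrow>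
     ('a, 'm) metric_components \<Rightarrow> bool" where
  "complete_riemannian A g \<longleftrightarrow> Metric_space.mcomplete UNIV (riemannian_dist A g)"


section \<open>Harmonic maps into flat space\<close>

text \<open>In the following, \<open>G\<close> is the component matrix of the metric in a chart and \<open>F\<close> the
  coordinate expression of a map into flat space.  Since the Christoffel symbols of the target
  vanish, the covariant derivative of the differential involves those of the domain only.\<close>

definition partial_deriv ::
  "'m::finite \<Rightarrow> (real ^ 'm \<Rightarrow> 'f::real_normed_vector) \<Rightarrow> real ^ 'm \<Rightarrow> 'f" where
  "partial_deriv i F x = frechet_derivative F (at x) (axis i 1)"

text \<open>\<open>christoffel G k i j x\<close> has upper index \<open>k\<close> and lower indices \<open>i\<close>, \<open>j\<close>.\<close>

definition christoffel ::
  "(real ^ 'm \<Rightarrow> real ^ 'm ^ 'm) \<Rightarrow> 'm::finite \<Rightarrow> 'm \<Rightarrow> 'm \<Rightarrow> real ^ 'm \<Rightarrow> real" where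
  "christoffel G k i j x =
     (1 / 2) * (\<Sum>l\<in>UNIV. matrix_inv (G x) $ k $ l *
       (partial_deriv i (\<lambda>y. G y $ j $ l) x + partial_deriv j (\<lambda>y. G y $ i $ l) x
         - partial_deriv l (\<lambda>y. G y $ i $ j) x))"

definition nabla_d ::
  "(real ^ 'm \<Rightarrow> real ^ 'm ^ 'm) \<Rightarrow> (real ^ 'm \<Rightarrow> 'f::real_normed_vector) \<Rightarrow>
     'm::finite \<Rightarrow> 'm \<Rightarrow> real ^ 'm \<Rightarrow> 'f" where
  "nabla_d G F i j x =
     partial_deriv i (partial_deriv j F) x
       - (\<Sum>k\<in>UNIV. christoffel G k i j x *\<^sub>R partial_deriv k F x)"

definition tension_field ::
  "(real ^ 'm \<Rightarrow> real ^ 'm ^ 'm) \<Rightarrow> (real ^ 'm::finite \<Rightarrow> 'f::real_normed_vector) \<Rightarrow>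
     real ^ 'm \<Rightarrow> 'f" where
  "tension_field G F x =
     (\<Sum>i\<in>UNIV. \<Sum>j\<in>UNIV. (matrix_inv (G x) $ i $ j) *\<^sub>R nabla_d G F i j x)"

definition harmonic_map ::
  "('a::{t2_space,second_countable_topology}, 'm::finite) chart set \<Rightarrow>
     ('a, 'm) metric_components \<Rightarrow> ('a \<Rightarrow> real ^ 'n) \<Rightarrow> bool" where
  "harmonic_map A g f \<longleftrightarrow>
     smooth_map A f \<and>
     (\<forall>c\<in>A. \<forall>x\<in>snd c ` fst c. tension_field (g c) (f \<circ> chart_inv c) x = 0)"

definition proper :: "('a::topological_space \<Rightarrow> 'b::topological_space) \<Rightarrow> bool" where
  "proper f \<longleftrightarrow> (\<forall>K. compact K \<longrightarrow> compact (f -` K))"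


section \<open>Perturbed cones\<close>

definition affine_hyperplane :: "(real ^ 'n) set \<Rightarrow> bool" where
  "affine_hyperplane H \<longleftrightarrow> (\<exists>a b. a \<noteq> 0 \<and> H = {x. a \<bullet> x = b})"

text \<open>The condition \<open>p \<notin> H\<close> is implicit in speaking of the component containing \<open>p\<close>; it must
  be explicit because \<open>connected_component_set S p\<close> is empty for \<open>p \<notin> S\<close>.\<close>

definition enclosing_property :: "(real ^ 'n) set \<Rightarrow> bool" where
  "enclosing_property R \<longleftrightarrow>
     open R \<and> connected R \<and>
     (\<forall>p\<in>R. \<exists>H. affine_hyperplane H \<and> p \<notin> H \<and>
        compact (closure (connected_component_set (R - H) p)))"

definition cone_region :: "(real ^ 'n) set \<Rightarrow> (real ^ 'n) set \<Rightarrow> bool" where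
  "cone_region C R \<longleftrightarrow>
     closed C \<and> path_connected C \<and>
     (\<exists>U\<in>components (- C). \<exists>V\<in>components (- C). U \<noteq> V) \<and>
     R \<in> components (- C) \<and> enclosing_property R"

definition perturbed_cone :: "(real ^ 'n) set \<Rightarrow> bool" where
  "perturbed_cone C \<longleftrightarrow> (\<exists>R. cone_region C R)"

end

theory Submission
  imports Defs
begin

text \<open>
  Let \<open>p\<close> be a point of the image, \<open>H = {x. d \<bullet> x = b}\<close> a hyperplane enclosing it with
  \<open>b < d \<bullet> p\<close>, and \<open>B\<close> the component of \<open>R - H\<close> containing \<open>p\<close>.  By properness the preimage \<open>K\<close> of
  the closure of \<open>B\<close> is compact, and the points of \<open>K\<close> that do not map into the open set \<open>B\<close>
  map into \<open>H\<close>.  Hence the maximum over \<open>K\<close> of the harmonic function \<open>d \<bullet> f\<close> is attained only in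
  the open preimage of \<open>B\<close>.  By the strong maximum principle the set where it is attained is open;
  it is also closed, hence everything.  So \<open>K\<close> is the whole manifold, which is therefore compact,
  and every coordinate of \<open>f\<close> is constant by the strong maximum principle again.
\<close>

section \<open>Positive definite matrices\<close>

definition pos_semidef :: "real ^ 'm ^ 'm \<Rightarrow> bool" where
  "pos_semidef A \<longleftrightarrow> (\<forall>v. 0 \<le> v \<bullet> (A *v v))"

lemma symmetric_dot_commute:
  fixes A :: "real ^ 'm ^ 'm"
  assumes "transpose A = A"
  shows "v \<bullet> (A *v w) = w \<bullet> (A *v v)"
  using dot_lmul_matrix[of v A w] by (simp add: transpose_matrix_vector[symmetric] assms inner_commute)

lemma axis_dot_matrix_axis: "axis i 1 \<bullet> (A *v axis j 1) = A $ i $ j" for A :: "real ^ 'm ^ 'n"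
  by (simp add: inner_axis' matrix_vector_mul_component inner_axis)

lemma inner_outer_product:
  fixes Q :: "real ^ 'm ^ 'm"
  shows "(\<chi> i j. c $ i * c $ j) \<bullet> Q = c \<bullet> (Q *v c)"
  by (simp add: inner_vec_def matrix_vector_mult_def sum_distrib_left ac_simps)

text \<open>Along \<open>t *\<^sub>R axis k 1 + axis j 1\<close> the quadratic form is affine in
  \<open>t\<close> with slope \<open>2 * A $ k $ j\<close>. A nonzero slope would force negative
  values.\<close>

lemma pos_semidef_zero_diagonal:
  fixes A :: "real ^ 'm ^ 'm"
  assumes sym: "transpose A = A" and psd: "pos_semidef A" and k: "A $ k $ k = 0"
  shows "A $ k $ j = 0"
proof (rule ccontr)
  assume nz: "A $ k $ j \<noteq> 0"
  \<comment> \<open>Chosen so that the quadratic form takes the value -1.\<close>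
  define t where "t = - (A $ j $ j + 1) / (2 * A $ k $ j)"
  define v :: "real ^ 'm" where "v = t *\<^sub>R axis k 1 + axis j 1"
  have "A $ j $ k = A $ k $ j"
    by (metis sym transpose_def vec_lambda_beta)
  then have "v \<bullet> (A *v v) = 2 * t * A $ k $ j + A $ j $ j"
    unfolding v_def
    by (simp add: matrix_vector_right_distrib matrix_vector_mult_scaleR inner_add_left inner_add_right
        axis_dot_matrix_axis k)
  also have "\<dots> = -1"
    using nz by (simp add: t_def field_simps)
  finally show False
    using psd by (simp add: pos_semidef_def) (metis neg_0_le_iff_le not_one_le_zero)
qed

text \<open>The inner product of matrices is the trace pairing.  Splitting off rank-one summands
  (completing the square) avoids the spectral theorem.\<close>

lemma inner_pos_semidef_nonneg_aux:
  fixes A Q :: "real ^ 'm ^ 'm"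
  assumes "finite S" and "transpose A = A" and "pos_semidef A" and "pos_semidef Q"
    and "\<And>i j. i \<notin> S \<Longrightarrow> A $ i $ j = 0"
  shows "0 \<le> A \<bullet> Q"
  using assms
proof (induction S arbitrary: A rule: finite_induct)
  case empty
  then have "A = 0" by (simp add: vec_eq_iff)
  then show ?case by simp
next
  case (insert k S)
  note sym = insert.prems(1)
  have symc: "A $ i $ j = A $ j $ i" for i j
    by (metis sym transpose_def vec_lambda_beta)
  show ?case
  proof (cases "A $ k $ k = 0")
    case True
    then have "A $ k $ j = 0" for j
      using pos_semidef_zero_diagonal insert.prems by blast
    then show ?thesis
      using insert by (metis insert_iff)
  next
    case False
    have kk: "A $ k $ k > 0"
      using insert.prems(2) False unfolding pos_semidef_def
      by (metis axis_dot_matrix_axis order_le_less)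
    define c where "c = A $ k"
    define P where "P = (\<chi> i j. c $ i * c $ j)"
    define A' where "A' = A - (1 / A $ k $ k) *\<^sub>R P"
    have c: "axis k 1 \<bullet> (A *v v) = c \<bullet> v" for v
      by (simp add: inner_axis' matrix_vector_mul_component c_def)
    have Pv: "P *v v = (c \<bullet> v) *\<^sub>R c" for v
      by (simp add: P_def vec_eq_iff matrix_vector_mult_def inner_vec_def sum_distrib_left
          sum_distrib_right ac_simps)
    have "transpose A' = A'"
      using symc by (simp add: A'_def P_def transpose_def vec_eq_iff)
    moreover have "pos_semidef A'"
      unfolding pos_semidef_def
    proof
      fix v
      \<comment> \<open>This \<open>s\<close> minimizes the form of \<open>A\<close> along the line
        \<open>v - s *\<^sub>R axis k 1\<close>. The minimum is the form of \<open>A'\<close> at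
        \<open>v\<close>, hence nonnegative.\<close>
      define s where "s = (c \<bullet> v) / A $ k $ k"
      define w where "w = v - s *\<^sub>R axis k 1"
      have "w \<bullet> (A *v w) = v \<bullet> (A *v v) - 2 * s * (c \<bullet> v) + s * s * A $ k $ k"
        unfolding w_def
        by (simp add: matrix_vector_mult_diff_distrib matrix_vector_mult_scaleR inner_diff_left inner_diff_right
            axis_dot_matrix_axis symmetric_dot_commute[OF sym, of v "axis k 1"] c algebra_simps)
      also have "\<dots> = v \<bullet> (A *v v) - (c \<bullet> v)\<^sup>2 / A $ k $ k"
        using kk by (simp add: s_def field_simps power2_eq_square)
      also have "\<dots> = v \<bullet> (A' *v v)"
        by (simp add: A'_def matrix_vector_mult_diff_rdistrib scaleR_matrix_vector_assoc[symmetric] Pv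
            inner_diff_right power2_eq_square inner_commute)
      finally show "0 \<le> v \<bullet> (A' *v v)"
        using insert.prems(2) by (simp add: pos_semidef_def) (metis)
    qed
    moreover have "A' $ i $ j = 0" if "i \<notin> S" for i j
    proof (cases "i = k")
      case True
      then show ?thesis
        using False by (simp add: A'_def P_def c_def)
    next
      case False
      with that have "A $ i $ j = 0" "A $ i $ k = 0"
        using insert.prems(4) by auto
      then show ?thesis
        by (simp add: A'_def P_def c_def symc)
    qed
    ultimately have "0 \<le> A' \<bullet> Q"
      using insert.IH insert.prems(3) by blast
    moreover have "A \<bullet> Q = A' \<bullet> Q + (1 / A $ k $ k) * (P \<bullet> Q)"
      by (simp add: A'_def inner_diff_left)
    moreover have "0 \<le> P \<bullet> Q"
      using insert.prems(3) by (simp add: P_def inner_outer_product pos_semidef_def)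
    ultimately show ?thesis
      using kk by simp
  qed
qed

lemma inner_pos_semidef_nonneg:
  fixes A Q :: "real ^ 'm ^ 'm"
  assumes "transpose A = A" and "pos_semidef A" and "pos_semidef Q"
  shows "0 \<le> A \<bullet> Q"
  using inner_pos_semidef_nonneg_aux[of UNIV] assms by simp

section \<open>Inverses of positive definite matrices and their continuity\<close>

definition pos_def :: "real ^ 'm ^ 'm \<Rightarrow> bool" where
  "pos_def A \<longleftrightarrow> (\<forall>v. v \<noteq> 0 \<longrightarrow> 0 < v \<bullet> (A *v v))"

lemma pos_def_imp_pos_semidef: "pos_def A \<Longrightarrow> pos_semidef A"
  unfolding pos_def_def pos_semidef_def by (metis inner_zero_left less_imp_le order_refl)

text \<open>Positivity makes the kernel trivial, which gives a left inverse. For square matrices it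
  is two-sided, so the choice in \<open>matrix_inv\<close> is a genuine one.\<close>

lemma pos_def_matrix_inv:
  fixes G :: "real ^ 'm ^ 'm"
  assumes "pos_def G"
  shows "G ** matrix_inv G = mat 1" and "matrix_inv G ** G = mat 1"
proof -
  have "\<forall>v. G *v v = 0 \<longrightarrow> v = 0"
    using assms unfolding pos_def_def by (metis inner_zero_right less_irrefl)
  then obtain B where "B ** G = mat 1"
    using matrix_left_invertible_ker by blast
  then have "\<exists>B. G ** B = mat 1 \<and> B ** G = mat 1"
    using matrix_left_right_inverse by blast
  then have "G ** matrix_inv G = mat 1 \<and> matrix_inv G ** G = mat 1"
    unfolding matrix_inv_def by (rule someI_ex)
  then show "G ** matrix_inv G = mat 1" "matrix_inv G ** G = mat 1" by auto
qed

lemma symmetric_matrix_inv: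
  fixes G :: "real ^ 'm ^ 'm"
  assumes "pos_def G" and "transpose G = G"
  shows "transpose (matrix_inv G) = matrix_inv G"
proof -
  have "transpose (matrix_inv G) ** G = mat 1"
    using pos_def_matrix_inv(1)[OF assms(1)] assms(2)
    by (metis matrix_transpose_mul transpose_mat)
  then show ?thesis
    using pos_def_matrix_inv(1)[OF assms(1)]
    by (metis matrix_mul_assoc matrix_mul_lid matrix_mul_rid)
qed

text \<open>The substitution \<open>v = G *v w\<close> turns the form of the inverse at
  \<open>v\<close> into the form of \<open>G\<close> at \<open>w\<close>.\<close>

lemma pos_def_inverse:
  fixes G :: "real ^ 'm ^ 'm"
  assumes "pos_def G" and "transpose G = G"
  shows "pos_def (matrix_inv G)"
  unfolding pos_def_def
proof (intro allI impI)
  fix v :: "real ^ 'm"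
  assume v: "v \<noteq> 0"
  define w where "w = matrix_inv G *v v"
  have Gw: "G *v w = v"
    by (simp add: w_def matrix_vector_mul_assoc pos_def_matrix_inv[OF assms(1)])
  with v have "w \<noteq> 0" by auto
  then have "0 < w \<bullet> (G *v w)"
    using assms(1) by (simp add: pos_def_def)
  then show "0 < v \<bullet> (matrix_inv G *v v)"
    using Gw by (simp add: w_def inner_commute)
qed

lemma continuous_on_det:
  fixes M :: "'x::topological_space \<Rightarrow> real ^ 'm ^ 'm"
  assumes "\<And>i j. continuous_on S (\<lambda>x. M x $ i $ j)"
  shows "continuous_on S (\<lambda>x. det (M x))"
  unfolding det_def by (intro continuous_intros assms)

text \<open>By Cramer's rule an entry of the inverse is a quotient of determinants, which are
  polynomials in the entries of \<open>G\<close>.\<close>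

lemma continuous_on_matrix_inv_component:
  fixes G :: "'x::topological_space \<Rightarrow> real ^ 'm ^ 'm"
  assumes cont: "continuous_on S G" and pd: "\<And>x. x \<in> S \<Longrightarrow> pos_def (G x)"
  shows "continuous_on S (\<lambda>x. matrix_inv (G x) $ k $ l)"
proof -
  have det: "det (G x) \<noteq> 0" if "x \<in> S" for x
    using pos_def_matrix_inv[OF pd[OF that]] invertible_det_nz invertible_def by blast
  \<comment> \<open>\<open>G x\<close> with column \<open>k\<close> replaced by the right-hand side
    of the system that column \<open>l\<close> of the inverse solves.\<close>
  define N where "N x = (\<chi> i j. if j = k then axis l 1 $ i else G x $ i $ j)" for x
  have "matrix_inv (G x) $ k $ l = det (N x) / det (G x)" if "x \<in> S" for x
  proof -
    have "G x *v (matrix_inv (G x) *v axis l 1) = axis l 1"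
      by (simp add: matrix_vector_mul_assoc pos_def_matrix_inv[OF pd[OF that]])
    then have "matrix_inv (G x) *v axis l 1 = (\<chi> k. det (\<chi> i j. if j = k then axis l 1 $ i else G x $ i $ j) / det (G x))"
      using cramer[OF det[OF that]] by blast
    then have "(matrix_inv (G x) *v axis l 1) $ k = det (N x) / det (G x)"
      by (simp add: N_def)
    then show ?thesis
      by (simp add: matrix_vector_mul_component inner_axis)
  qed
  moreover have "continuous_on S (\<lambda>x. N x $ i $ j)" for i j
    by (cases "j = k") (auto simp: N_def intro!: continuous_intros cont)
  then have detN: "continuous_on S (\<lambda>x. det (N x))"
    by (rule continuous_on_det)
  have detG: "continuous_on S (\<lambda>x. det (G x))"
    by (rule continuous_on_det) (rule continuous_on_component[OF continuous_on_component[OF cont]])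
  have "continuous_on S (\<lambda>x. det (N x) / det (G x))"
    by (rule continuous_on_divide[OF detN detG]) (use det in auto)
  ultimately show ?thesis
    by (simp cong: continuous_on_cong)
qed

section \<open>The strong maximum principle\<close>

text \<open>Carrying the partial derivatives as explicit functions lets those of the barrier be
  closed formulas and those of a harmonic map be \<open>partial_deriv\<close> terms.\<close>

definition has_partials ::
  "(real ^ 'm) set \<Rightarrow> (real ^ 'm \<Rightarrow> real) \<Rightarrow> ('m::finite \<Rightarrow> real ^ 'm \<Rightarrow> real) \<Rightarrow>
     ('m \<Rightarrow> 'm \<Rightarrow> real ^ 'm \<Rightarrow> real) \<Rightarrow> bool" where
  "has_partials U u u1 u2 \<longleftrightarrow>
     (\<forall>x\<in>U. (u has_derivative (\<lambda>h. \<Sum>j\<in>UNIV. h $ j * u1 j x)) (at x)) \<and>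
     (\<forall>x\<in>U. \<forall>j. (u1 j has_derivative (\<lambda>h. \<Sum>i\<in>UNIV. h $ i * u2 i j x)) (at x))"

lemma has_partials_subset: "has_partials U u u1 u2 \<Longrightarrow> V \<subseteq> U \<Longrightarrow> has_partials V u u1 u2"
  by (auto simp: has_partials_def)

lemma has_partials_continuous_on: "has_partials U u u1 u2 \<Longrightarrow> continuous_on U u"
  unfolding has_partials_def
  by (meson continuous_at_imp_continuous_on has_derivative_continuous)

lemma has_partials_add_scaled:
  assumes "has_partials U u u1 u2" and "has_partials U w w1 w2"
  shows "has_partials U (\<lambda>x. u x + e * w x) (\<lambda>j x. u1 j x + e * w1 j x)
           (\<lambda>i j x. u2 i j x + e * w2 i j x)"
proof -
  have lin: "(\<lambda>h. \<Sum>j\<in>UNIV. h $ j * (p j + e * q j)) =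
      (\<lambda>h. (\<Sum>j\<in>UNIV. h $ j * p j) + e * (\<Sum>j\<in>UNIV. h $ j * q j))"
    for p q :: "'a \<Rightarrow> real"
    by (simp add: sum_distrib_left sum.distrib algebra_simps)
  show ?thesis
    using assms unfolding has_partials_def lin
    by (auto intro!: has_derivative_add has_derivative_mult_right)
qed

text \<open>Restriction to lines through \<open>z\<close> shows that the Hessian form is nonpositive
  there. Pairing its negative with the positive definite \<open>A\<close> gives the sign of the
  trace.\<close>

lemma interior_max_second_order:
  fixes A :: "real ^ 'm ^ 'm"
  assumes part: "has_partials U u u1 u2" and U: "open U" "z \<in> U"
    and max: "\<And>x. x \<in> U \<Longrightarrow> u x \<le> u z"
    and A: "transpose A = A" "pos_def A"
  shows "u1 j z = 0" and "A \<bullet> (\<chi> i j. u2 i j z) \<le> 0"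
proof -
  have D: "(u has_derivative (\<lambda>h. \<Sum>j\<in>UNIV. h $ j * u1 j x)) (at x)" if "x \<in> U" for x
    using part that by (simp add: has_partials_def)
  have D2: "(u1 j has_derivative (\<lambda>h. \<Sum>i\<in>UNIV. h $ i * u2 i j x)) (at x)" if "x \<in> U" for x j
    using part that by (simp add: has_partials_def)
  have "(\<lambda>h. \<Sum>j\<in>UNIV. h $ j * u1 j z) = (\<lambda>h. 0)"
    using differential_zero_maxmin[OF U(2,1) D[OF U(2)]] max by blast
  from fun_cong[OF this, of "axis j 1" for j] have grad: "u1 j z = 0" for j
    by (simp add: axis_def if_distrib[of "\<lambda>x. x * _"] cong: if_cong)
  then show "u1 j z = 0" .
  define H :: "real ^ 'm ^ 'm" where "H = (\<chi> i j. u2 i j z)"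
  have "v \<bullet> (H *v v) \<le> 0" for v
  proof (rule ccontr)
    assume pos: "\<not> v \<bullet> (H *v v) \<le> 0"
    \<comment> \<open>The derivative of \<open>u\<close> along the line through \<open>z\<close> in
      direction \<open>v\<close>. It vanishes at 0 and has derivative
      \<open>v \<bullet> (H *v v)\<close> there.\<close>
    define \<psi> where "\<psi> t = (\<Sum>j\<in>UNIV. v $ j * u1 j (z + t *\<^sub>R v))" for t :: real
    have "open ((\<lambda>t::real. z + t *\<^sub>R v) -` U)"
      by (intro open_vimage U(1) continuous_intros)
    moreover have "0 \<in> (\<lambda>t::real. z + t *\<^sub>R v) -` U"
      using U by simp
    ultimately obtain \<delta> where \<delta>: "\<delta> > 0" "ball 0 \<delta> \<subseteq> (\<lambda>t::real. z + t *\<^sub>R v) -` U"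
      by (meson openE)
    have inU: "z + t *\<^sub>R v \<in> U" if "\<bar>t\<bar> < \<delta>" for t
      using \<delta>(2) that by (auto simp: subset_iff dist_real_def)
    have line: "((\<lambda>t. z + t *\<^sub>R v) has_derivative (\<lambda>h. h *\<^sub>R v)) (at t)" for t
      by (auto intro!: derivative_eq_intros)
    have mult: "(\<lambda>h::real. \<Sum>j\<in>UNIV. (h *\<^sub>R v) $ j * c j) = (*) (\<Sum>j\<in>UNIV. v $ j * c j)" for c
    proof
      fix h :: real
      have "(\<Sum>j\<in>UNIV. (h *\<^sub>R v) $ j * c j) = (\<Sum>j\<in>UNIV. h * (v $ j * c j))"
        by (simp add: mult.assoc)
      also have "\<dots> = (\<Sum>j\<in>UNIV. v $ j * c j) * h"
        by (simp add: sum_distrib_left[symmetric] mult.commute)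
      finally show "(\<Sum>j\<in>UNIV. (h *\<^sub>R v) $ j * c j) = (\<Sum>j\<in>UNIV. v $ j * c j) * h" .
    qed
    have \<phi>: "((\<lambda>t. u (z + t *\<^sub>R v)) has_real_derivative \<psi> t) (at t)" if "\<bar>t\<bar> < \<delta>" for t
      unfolding has_field_derivative_def \<psi>_def mult[symmetric]
      by (rule has_derivative_compose[OF line D[OF inU[OF that]]])
    \<comment> \<open>The base point is written as the value of the line at parameter 0, the form in
      which the chain rule expects it.\<close>
    have D0: "(u1 j has_derivative (\<lambda>h. \<Sum>i\<in>UNIV. h $ i * u2 i j z)) (at (z + 0 *\<^sub>R v))" for j
      using D2[OF U(2)] by simp
    have "((\<lambda>t. u1 j (z + t *\<^sub>R v)) has_real_derivative (\<Sum>i\<in>UNIV. v $ i * u2 i j z)) (at 0)" for j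
      unfolding has_field_derivative_def mult[symmetric]
      by (rule has_derivative_compose[OF line D0])
    then have "(\<psi> has_real_derivative (\<Sum>j\<in>UNIV. v $ j * (\<Sum>i\<in>UNIV. v $ i * u2 i j z))) (at 0)"
      unfolding \<psi>_def by (intro DERIV_sum DERIV_cmult)
    moreover have "(\<Sum>j\<in>UNIV. v $ j * (\<Sum>i\<in>UNIV. v $ i * u2 i j z)) = v \<bullet> (H *v v)"
      unfolding sum_distrib_left
      by (subst sum.swap)
        (simp add: inner_vec_def H_def matrix_vector_mult_def sum_distrib_left mult.commute mult.left_commute)
    ultimately have "(\<psi> has_real_derivative v \<bullet> (H *v v)) (at 0)" by simp
    \<comment> \<open>A positive derivative at 0 makes \<open>\<psi>\<close> positive just to the
      right of 0. By the mean value theorem \<open>u\<close> then exceeds its maximum.\<close>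
    then obtain d where d: "d > 0" "\<And>h. 0 < h \<Longrightarrow> h < d \<Longrightarrow> \<psi> 0 < \<psi> (0 + h)"
      using DERIV_pos_inc_right pos by (metis not_le)
    define t where "t = min (\<delta> / 2) (d / 2)"
    have t: "0 < t" "t < \<delta>" "t < d"
      using \<delta>(1) d(1) by (auto simp: t_def min_def)
    have "\<exists>s. 0 < s \<and> s < t \<and> u (z + t *\<^sub>R v) - u (z + 0 *\<^sub>R v) = (t - 0) * \<psi> s"
      using t by (intro MVT2 \<phi>) auto
    then obtain s where s: "0 < s" "s < t" "u (z + t *\<^sub>R v) - u z = t * \<psi> s"
      by auto
    have "\<psi> 0 = 0"
      by (simp add: \<psi>_def grad)
    then have "0 < t * \<psi> s"
      using d(2)[of s] s t by simp
    then show False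
      using max[OF inU[of t]] s(3) t by auto
  qed
  moreover have "v \<bullet> ((- H) *v v) = - (v \<bullet> (H *v v))" for v
    by (simp add: matrix_vector_mult_def inner_vec_def sum_negf)
  ultimately have "pos_semidef (- H)"
    unfolding pos_semidef_def by simp
  from inner_pos_semidef_nonneg[OF A(1) pos_def_imp_pos_semidef[OF A(2)] this]
  show "A \<bullet> (\<chi> i j. u2 i j z) \<le> 0"
    by (simp add: H_def)
qed

section \<open>The Gaussian barrier and Hopf's argument\<close>

lemma has_partials_gaussian:
  fixes y :: "real ^ 'm"
  shows "has_partials UNIV (\<lambda>x. exp (- \<alpha> * ((x - y) \<bullet> (x - y))) - c)
     (\<lambda>j x. - 2 * \<alpha> * (x - y) $ j * exp (- \<alpha> * ((x - y) \<bullet> (x - y))))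
     (\<lambda>i j x. (4 * \<alpha>\<^sup>2 * (x - y) $ i * (x - y) $ j - 2 * \<alpha> * (if i = j then 1 else 0)) *
        exp (- \<alpha> * ((x - y) \<bullet> (x - y))))"
proof -
  have E: "((\<lambda>x. exp (- \<alpha> * ((x - y) \<bullet> (x - y)))) has_derivative
      (\<lambda>h. - 2 * \<alpha> * (h \<bullet> (x - y)) * exp (- \<alpha> * ((x - y) \<bullet> (x - y))))) (at x)" for x
    by (auto intro!: derivative_eq_intros simp: inner_commute)
  have "(\<lambda>h. - 2 * \<alpha> * (h \<bullet> (x - y)) * exp (- \<alpha> * ((x - y) \<bullet> (x - y)))) =
      (\<lambda>h. \<Sum>j\<in>UNIV. h $ j * (- 2 * \<alpha> * (x - y) $ j * exp (- \<alpha> * ((x - y) \<bullet> (x - y)))))" for x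
    by (simp add: inner_vec_def[of _ "x - y"] sum_distrib_left sum_distrib_right mult_ac
        cong: sum.cong del: vector_minus_component)
  note E' = E[unfolded this]
  have 1: "((\<lambda>x. exp (- \<alpha> * ((x - y) \<bullet> (x - y))) - c) has_derivative
      (\<lambda>h. \<Sum>j\<in>UNIV. h $ j * (- 2 * \<alpha> * (x - y) $ j * exp (- \<alpha> * ((x - y) \<bullet> (x - y)))))) (at x)" for x
    using has_derivative_diff[OF E'[of x] has_derivative_const[of c]] by simp
  have comp: "((\<lambda>x. - 2 * \<alpha> * (x - y) $ j) has_derivative (\<lambda>h. - 2 * \<alpha> * h $ j)) (at x)" for x j
  proof -
    have "((\<lambda>x. (x - y) $ j) has_derivative (\<lambda>h. (h - 0) $ j)) (at x)"
      by (intro bounded_linear.has_derivative[OF bounded_linear_vec_nth] has_derivative_diff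
          has_derivative_ident has_derivative_const)
    then show ?thesis
      using has_derivative_mult_right[of "\<lambda>x. (x - y) $ j" _ _ "- 2 * \<alpha>"] by simp
  qed
  \<comment> \<open>Product rule: the linear factor contributes the Kronecker term, the exponential
    the quadratic one.\<close>
  have 2: "((\<lambda>x. - 2 * \<alpha> * (x - y) $ j * exp (- \<alpha> * ((x - y) \<bullet> (x - y)))) has_derivative
      (\<lambda>h. \<Sum>i\<in>UNIV. h $ i * ((4 * \<alpha>\<^sup>2 * (x - y) $ i * (x - y) $ j
         - 2 * \<alpha> * (if i = j then 1 else 0)) * exp (- \<alpha> * ((x - y) \<bullet> (x - y)))))) (at x)" for x j
  proof (rule has_derivative_eq_rhs[OF has_derivative_mult[OF comp E]], rule ext)
    fix h :: "real ^ 'm"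
    let ?e = "exp (- \<alpha> * ((x - y) \<bullet> (x - y)))"
    have "(\<Sum>i\<in>UNIV. h $ i * ((4 * \<alpha>\<^sup>2 * (x - y) $ i * (x - y) $ j - 2 * \<alpha> * (if i = j then 1 else 0)) * ?e))
      = (\<Sum>i\<in>UNIV. 4 * \<alpha>\<^sup>2 * (x - y) $ j * ?e * (h $ i * (x - y) $ i))
          - (\<Sum>i\<in>UNIV. if i = j then 2 * \<alpha> * ?e * h $ i else 0)"
      unfolding sum_subtractf[symmetric] by (rule sum.cong) (auto simp: algebra_simps)
    also have "\<dots> = 4 * \<alpha>\<^sup>2 * (x - y) $ j * ?e * (h \<bullet> (x - y)) - 2 * \<alpha> * ?e * h $ j"
      by (simp add: inner_vec_def[of _ "x - y"] sum_distrib_left del: vector_minus_component)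
    finally show "- 2 * \<alpha> * (x - y) $ j * (- 2 * \<alpha> * (h \<bullet> (x - y)) * ?e) + - 2 * \<alpha> * h $ j * ?e =
       (\<Sum>i\<in>UNIV. h $ i * ((4 * \<alpha>\<^sup>2 * (x - y) $ i * (x - y) $ j - 2 * \<alpha> * (if i = j then 1 else 0)) * ?e))"
      by (simp add: power2_eq_square del: vector_minus_component)
  qed
  from 1 2 show ?thesis
    unfolding has_partials_def by blast
qed

text \<open>Hopf's barrier argument: \<open>exp (- \<alpha> |x - y|\<^sup>2)\<close> is strictly subharmonic near \<open>z\<close> for large \<open>\<alpha>\<close>,
  so adding a small multiple of it to \<open>u\<close> contradicts the second-order test at a maximum.\<close>

lemma hopf_touching_ball:
  fixes a :: "real ^ 'm \<Rightarrow> real ^ 'm ^ 'm" and b :: "real ^ 'm \<Rightarrow> real ^ 'm"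
  assumes U: "open U" and part: "has_partials U u u1 u2"
    and cont: "continuous_on U a" "continuous_on U b"
    and a: "\<And>x. x \<in> U \<Longrightarrow> transpose (a x) = a x" "\<And>x. x \<in> U \<Longrightarrow> pos_def (a x)"
    and sub: "\<And>x. x \<in> U \<Longrightarrow> 0 \<le> a x \<bullet> (\<chi> i j. u2 i j x) - b x \<bullet> (\<chi> k. u1 k x)"
    and le: "\<And>x. x \<in> U \<Longrightarrow> u x \<le> m"
    and z: "z \<in> U" "u z = m" "dist y z = r" "r > 0"
    and less: "\<And>x. x \<in> U \<Longrightarrow> dist y x < r \<Longrightarrow> u x < m"
  shows False
proof -
  text \<open>Replace the ball by a smaller one, internally tangent at \<open>z\<close>, so that \<open>u < m\<close> on its closure except at \<open>z\<close>.\<close>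
  define y' where "y' = (1/2) *\<^sub>R (y + z)"
  have zy': "z - y' = y' - y"
    by (simp add: y'_def vec_eq_iff field_simps)
  have yz: "z - y = 2 *\<^sub>R (z - y')"
    by (simp add: y'_def vec_eq_iff field_simps)
  have r: "r = 2 * norm (z - y')"
    using z(3) yz by (metis abs_numeral dist_commute dist_norm norm_scaleR)
  have small: "u x < m" if "x \<in> U" "x \<noteq> z" "norm (x - y') \<le> norm (z - y')" for x
  proof (rule less)
    \<comment> \<open>By the parallelogram law, \<open>p + q = x - y\<close> is strictly shorter
      than \<open>2 * norm q = r\<close> unless \<open>p = q\<close>, that is,
      \<open>x = z\<close>.\<close>
    define p q where "p = x - y'" and "q = z - y'"
    have "(norm (p + q))\<^sup>2 + (norm (p - q))\<^sup>2 = 2 * (norm p)\<^sup>2 + 2 * (norm q)\<^sup>2"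
      by (simp add: power2_norm_eq_inner inner_add_left inner_add_right inner_diff_left inner_diff_right)
    moreover have "(norm p)\<^sup>2 \<le> (norm q)\<^sup>2"
      using that(3) by (simp add: p_def q_def)
    moreover have "(norm (p - q))\<^sup>2 > 0"
      using that(2) by (simp add: p_def q_def)
    moreover have "(2 * norm q)\<^sup>2 = 4 * (norm q)\<^sup>2"
      by (simp add: power_mult_distrib)
    ultimately have "(norm (p + q))\<^sup>2 < (2 * norm q)\<^sup>2"
      by linarith
    then have "norm (p + q) < r"
      unfolding r q_def[symmetric] by (rule power_less_imp_less_base) simp
    moreover have "p + q = x - y"
      unfolding p_def q_def zy' by simp
    ultimately show "dist y x < r"
      by (simp add: dist_norm norm_minus_commute)
  qed (use that in simp)

  define \<xi> where "\<xi> = z - y'"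
  have "\<xi> \<noteq> 0"
    using r z(4) by (auto simp: \<xi>_def)
  then have q: "0 < \<xi> \<bullet> (a z *v \<xi>)"
    using a(2)[OF z(1)] by (simp add: pos_def_def)
  define s where "s = a z \<bullet> mat 1 - b z \<bullet> \<xi>"
  \<comment> \<open>Large enough for the quadratic term to dominate the trace and drift terms,
    collected in \<open>s\<close>: it makes \<open>P z\<close> equal to
    \<open>2 * (\<bar>s\<bar> + 1) - s\<close>.\<close>
  define \<alpha> where "\<alpha> = (\<bar>s\<bar> + 1) / (\<xi> \<bullet> (a z *v \<xi>))"
  \<comment> \<open>\<open>P\<close> is the operator applied to the Gaussian, divided by the
    positive factor \<open>2 * \<alpha> * E x\<close>. By continuity it stays positive on a closed
    ball about \<open>z\<close>.\<close>
  define P where "P x = 2 * \<alpha> * ((x - y') \<bullet> (a x *v (x - y'))) - (a x \<bullet> mat 1 - b x \<bullet> (x - y'))" for x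
  have \<alpha>: "\<alpha> > 0"
    using q by (simp add: \<alpha>_def)
  have "P z = 2 * (\<bar>s\<bar> + 1) - s"
    using q by (simp add: P_def \<xi>_def[symmetric] s_def[symmetric]) (simp add: \<alpha>_def)
  moreover have "s < 2 * (\<bar>s\<bar> + 1)"
    by (simp add: abs_if)
  ultimately have Pz: "P z > 0"
    by simp
  have contP: "continuous_on U P"
    unfolding P_def matrix_vector_mult_def by (intro continuous_intros cont)
  have "open (P -` {0<..} \<inter> U)"
    using continuous_on_open_vimage[OF U] contP open_greaterThan by blast
  moreover have "z \<in> P -` {0<..} \<inter> U"
    using Pz z(1) by simp
  ultimately obtain \<delta> where \<delta>: "\<delta> > 0" "cball z \<delta> \<subseteq> P -` {0<..} \<inter> U"
    by (meson open_contains_cball)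
  then have DU: "cball z \<delta> \<subseteq> U" and Ppos: "\<And>x. x \<in> cball z \<delta> \<Longrightarrow> P x > 0"
    by auto

  define E where "E x = exp (- \<alpha> * ((x - y') \<bullet> (x - y')))" for x
  \<comment> \<open>Normalized to vanish on the sphere about \<open>y'\<close> through
    \<open>z\<close>, to be positive inside it and negative outside.\<close>
  define w where "w x = E x - E z" for x
  define w1 where "w1 j x = - 2 * \<alpha> * (x - y') $ j * E x" for j x
  define w2 where "w2 i j x = (4 * \<alpha>\<^sup>2 * (x - y') $ i * (x - y') $ j - 2 * \<alpha> * (if i = j then 1 else 0)) * E x"
    for i j x
  have wpart: "has_partials U w w1 w2"
    using has_partials_subset[OF has_partials_gaussian[of \<alpha> y' "E z"], of U]
    by (simp add: w_def[abs_def] w1_def[abs_def] w2_def[abs_def] E_def del: vector_minus_component)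
  \<comment> \<open>The rank-one part of the Hessian pairs to the quadratic form, the multiple of
    the identity to the trace of \<open>a x\<close>.\<close>
  have Lw: "a x \<bullet> (\<chi> i j. w2 i j x) - b x \<bullet> (\<chi> k. w1 k x) = 2 * \<alpha> * E x * P x" for x
  proof -
    define p where "p = x - y'"
    have "(\<chi> i j. w2 i j x) =
        (4 * \<alpha>\<^sup>2 * E x) *\<^sub>R (\<chi> i j. p $ i * p $ j) - (2 * \<alpha> * E x) *\<^sub>R mat 1"
      by (simp add: w2_def p_def mat_def vec_eq_iff algebra_simps)
    moreover have "(\<chi> k. w1 k x) = (- (2 * \<alpha> * E x)) *\<^sub>R p"
      by (simp add: w1_def p_def vec_eq_iff)
    moreover have "a x \<bullet> (\<chi> i j. p $ i * p $ j) = p \<bullet> (a x *v p)"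
      by (metis inner_commute inner_outer_product)
    moreover have "P x = 2 * \<alpha> * (p \<bullet> (a x *v p)) - (a x \<bullet> mat 1 - b x \<bullet> p)"
      by (simp add: P_def p_def)
    ultimately show ?thesis
      by (simp add: inner_diff_right power2_eq_square right_diff_distrib del: mult_minus_left)
  qed

  \<comment> \<open>The part of the boundary of the small ball where \<open>w\<close> is
    nonnegative. There \<open>u < m\<close>, and compactness leaves a uniform gap.\<close>
  define S where "S = sphere z \<delta> \<inter> cball y' (norm (z - y'))"
  have "compact S"
    by (simp add: S_def compact_Int_closed)
  have SU: "S \<subseteq> U"
    using DU by (auto simp: S_def)
  have Sm: "u x < m" if "x \<in> S" for x
  proof (rule small)
    show "x \<in> U" using SU that by blast
    show "x \<noteq> z" using that \<delta>(1) by (auto simp: S_def)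
    show "norm (x - y') \<le> norm (z - y')" using that by (simp add: S_def dist_norm norm_minus_commute)
  qed
  obtain e where e: "e > 0" "\<And>x. x \<in> S \<Longrightarrow> u x + e * w x < m"
  proof (cases "S = {}")
    case True
    then show ?thesis using that[of 1] by auto
  next
    case False
    obtain x0 where x0: "x0 \<in> S" "\<And>x. x \<in> S \<Longrightarrow> u x \<le> u x0"
      using continuous_attains_sup[OF \<open>compact S\<close> False]
        continuous_on_subset[OF has_partials_continuous_on[OF part] SU] by blast
    \<comment> \<open>The gap itself serves as \<open>e\<close>, since \<open>w < 1\<close>
      everywhere.\<close>
    have "u x + (m - u x0) * w x < m" if "x \<in> S" for x
    proof -
      have "E x \<le> 1" "E z > 0"
        using \<alpha> by (auto simp: E_def)
      then have "w x < 1" by (simp add: w_def)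
      then have "(m - u x0) * w x < m - u x0"
        using Sm[OF x0(1)] by simp
      then show ?thesis using x0(2)[OF that] by simp
    qed
    then show ?thesis
      using that[of "m - u x0"] Sm[OF x0(1)] by simp
  qed

  define v where "v x = u x + e * w x" for x
  have vpart: "has_partials U v (\<lambda>j x. u1 j x + e * w1 j x) (\<lambda>i j x. u2 i j x + e * w2 i j x)"
    unfolding v_def[abs_def] by (rule has_partials_add_scaled[OF part wpart])
  obtain x0 where x0: "x0 \<in> cball z \<delta>" "\<And>x. x \<in> cball z \<delta> \<Longrightarrow> v x \<le> v x0"
    using continuous_attains_sup[OF compact_cball, of z \<delta> v] \<delta>(1)
      continuous_on_subset[OF has_partials_continuous_on[OF vpart] DU] by auto
  have "v z = m"
    by (simp add: v_def w_def z(2))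
  then have "m \<le> v x0"
    using x0(2)[of z] \<delta>(1) by simp
  have "x0 \<in> ball z \<delta>"
  proof (rule ccontr)
    assume "x0 \<notin> ball z \<delta>"
    with x0(1) have sph: "x0 \<in> sphere z \<delta>" by auto
    show False
    \<comment> \<open>On \<open>S\<close> the choice of \<open>e\<close> keeps \<open>v\<close>
      below \<open>m\<close>; on the rest of the sphere \<open>w\<close> is negative and
      \<open>u \<le> m\<close>.\<close>
    proof (cases "norm (x0 - y') \<le> norm (z - y')")
      case True
      then have "x0 \<in> S"
        using sph by (simp add: S_def dist_norm norm_minus_commute)
      then show False
        using e(2) \<open>m \<le> v x0\<close> by (force simp: v_def)
    next
      case False
      then have "(norm (z - y'))\<^sup>2 < (norm (x0 - y'))\<^sup>2"
        by (intro power_strict_mono) auto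
      then have "w x0 < 0"
        using \<alpha> by (simp add: w_def E_def power2_norm_eq_inner)
      then have "v x0 < m"
        using le[of x0] x0(1) DU mult_pos_neg[OF e(1)] by (fastforce simp: v_def)
      then show False
        using \<open>m \<le> v x0\<close> by simp
    qed
  qed
  moreover have xU: "x0 \<in> U"
    using x0(1) DU by auto
  have bU: "ball z \<delta> \<subseteq> U"
    using DU by auto
  \<comment> \<open>At the interior maximum \<open>x0\<close> the gradient of \<open>v\<close>
    vanishes, so the operator applied to \<open>v\<close> is nonpositive. Yet it is nonnegative on
    \<open>u\<close> and positive on \<open>e * w\<close>.\<close>
  note test = interior_max_second_order[OF has_partials_subset[OF vpart bU] open_ball calculation
      x0(2) a(1)[OF xU] a(2)[OF xU]]
  have g: "u1 k x0 + e * w1 k x0 = 0" for k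
    by (rule test) auto
  have h: "a x0 \<bullet> (\<chi> i j. u2 i j x0 + e * w2 i j x0) \<le> 0"
    by (rule test) auto
  have "(\<chi> k. u1 k x0) = - e *\<^sub>R (\<chi> k. w1 k x0)"
    using g by (simp add: vec_eq_iff add_eq_0_iff2)
  moreover have "(\<chi> i j. u2 i j x0 + e * w2 i j x0) = (\<chi> i j. u2 i j x0) + e *\<^sub>R (\<chi> i j. w2 i j x0)"
    by (simp add: vec_eq_iff)
  ultimately have "(a x0 \<bullet> (\<chi> i j. u2 i j x0) - b x0 \<bullet> (\<chi> k. u1 k x0))
      + e * (a x0 \<bullet> (\<chi> i j. w2 i j x0) - b x0 \<bullet> (\<chi> k. w1 k x0)) \<le> 0"
    using h by (simp add: inner_add_right algebra_simps)
  moreover have "0 < e * (a x0 \<bullet> (\<chi> i j. w2 i j x0) - b x0 \<bullet> (\<chi> k. w1 k x0))"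
    using e(1) \<alpha> Ppos[OF x0(1)] by (simp add: Lw E_def)
  ultimately show False
    using sub[OF xU] by linarith
qed

text \<open>If \<open>u < m\<close> at some \<open>y\<close> near \<open>x0\<close>, the largest
  open ball about \<open>y\<close> free of maximum points has one on its boundary, which Hopf's
  argument excludes.\<close>

theorem strong_maximum_principle:
  fixes a :: "real ^ 'm \<Rightarrow> real ^ 'm ^ 'm" and b :: "real ^ 'm \<Rightarrow> real ^ 'm"
  assumes U: "open U" and part: "has_partials U u u1 u2"
    and cont: "continuous_on U a" "continuous_on U b"
    and a: "\<And>x. x \<in> U \<Longrightarrow> transpose (a x) = a x" "\<And>x. x \<in> U \<Longrightarrow> pos_def (a x)"
    and sub: "\<And>x. x \<in> U \<Longrightarrow> 0 \<le> a x \<bullet> (\<chi> i j. u2 i j x) - b x \<bullet> (\<chi> k. u1 k x)"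
    and le: "\<And>x. x \<in> U \<Longrightarrow> u x \<le> m"
    and x0: "x0 \<in> U" "u x0 = m"
  shows "\<exists>e>0. ball x0 e \<subseteq> U \<and> (\<forall>x\<in>ball x0 e. u x = m)"
proof -
  obtain e where e: "e > 0" "cball x0 e \<subseteq> U"
    using U x0(1) open_contains_cball by blast
  \<comment> \<open>Half the radius: a maximum point nearest to \<open>y\<close> is at distance less
    than \<open>e / 2\<close>, since \<open>x0\<close> is, so the ball about \<open>y\<close>
    reaching up to it stays within \<open>cball x0 e\<close>.\<close>
  have "u y = m" if y: "y \<in> ball x0 (e / 2)" for y
  proof (rule ccontr)
    assume ne: "u y \<noteq> m"
    define Z where "Z = {x \<in> cball x0 e. u x = m}"
    have "closed Z"
      unfolding Z_def
      using continuous_closed_preimage_constant continuous_on_subset[OF has_partials_continuous_on[OF part] e(2)]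
      by blast
    moreover have x0Z: "x0 \<in> Z"
      using e(1) x0 by (simp add: Z_def)
    ultimately obtain z where z: "z \<in> Z" "\<And>x. x \<in> Z \<Longrightarrow> dist y z \<le> dist y x"
      using distance_attains_inf[of Z y] by auto
    have "dist y z < e / 2"
      using z(2)[OF x0Z] y by (simp add: dist_commute)
    show False
    proof (rule hopf_touching_ball[OF U part cont a sub le])
      show "z \<in> U" "u z = m" "dist y z = dist y z"
        using z(1) e(2) by (auto simp: Z_def)
      show "0 < dist y z"
        using z(1) ne by (auto simp: Z_def)
      fix x assume x: "x \<in> U" "dist y x < dist y z"
      then have "x \<notin> Z"
        using z(2) by force
      moreover have "x \<in> cball x0 e"
        using x(2) \<open>dist y z < e / 2\<close> y dist_triangle[of x0 x y] by simp
      ultimately show "u x < m"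
        using le[OF x(1)] by (simp add: Z_def)
    qed auto
  qed
  then show ?thesis
    using e by (intro exI[of _ "e / 2"]) (auto simp: subset_iff)
qed

section \<open>Harmonic maps\<close>

lemma smooth_on_imp_differentiable:
  "smooth_on S F \<Longrightarrow> x \<in> S \<Longrightarrow> F differentiable (at x)"
  unfolding smooth_on_def by (metis Ck_on.simps(2))

lemma smooth_on_imp_continuous_on: "smooth_on S F \<Longrightarrow> continuous_on S F"
  unfolding smooth_on_def by (metis Ck_on.simps(1))

lemma smooth_on_frechet_derivative:
  "smooth_on S F \<Longrightarrow> smooth_on S (\<lambda>x. frechet_derivative F (at x) v)"
  unfolding smooth_on_def by (metis Ck_on.simps(2))

lemma smooth_on_partial_deriv: "smooth_on S F \<Longrightarrow> smooth_on S (partial_deriv i F)"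
  using smooth_on_frechet_derivative[of S F "axis i 1"] by (simp add: partial_deriv_def[abs_def])

lemma has_derivative_partials:
  fixes F :: "real ^ 'm \<Rightarrow> 'f::real_normed_vector"
  assumes "F differentiable (at x)"
  shows "(F has_derivative (\<lambda>h. \<Sum>j\<in>UNIV. h $ j *\<^sub>R partial_deriv j F x)) (at x)"
proof -
  have D: "(F has_derivative frechet_derivative F (at x)) (at x)"
    using assms frechet_derivative_works by blast
  then interpret bounded_linear "frechet_derivative F (at x)"
    by (rule has_derivative_bounded_linear)
  have "frechet_derivative F (at x) h = (\<Sum>j\<in>UNIV. h $ j *\<^sub>R partial_deriv j F x)" for h
  proof -
    have "frechet_derivative F (at x) (\<Sum>j\<in>UNIV. h $ j *\<^sub>R axis j 1) =
        (\<Sum>j\<in>UNIV. h $ j *\<^sub>R partial_deriv j F x)"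
      by (simp add: sum scaleR partial_deriv_def)
    then show ?thesis
      using basis_expansion[of h] by (simp add: scalar_mult_eq_scaleR)
  qed
  then have "frechet_derivative F (at x) = (\<lambda>h. \<Sum>j\<in>UNIV. h $ j *\<^sub>R partial_deriv j F x)"
    by (rule ext)
  then show ?thesis
    using D by simp
qed

lemma has_partials_inner_smooth:
  fixes F :: "real ^ 'm \<Rightarrow> 'f::real_inner"
  assumes "smooth_on U F"
  shows "has_partials U (\<lambda>x. d \<bullet> F x) (\<lambda>j x. d \<bullet> partial_deriv j F x)
           (\<lambda>i j x. d \<bullet> partial_deriv i (partial_deriv j F) x)"
proof -
  have *: "((\<lambda>x. d \<bullet> E x) has_derivative (\<lambda>h. \<Sum>j\<in>UNIV. h $ j * (d \<bullet> partial_deriv j E x))) (at x)"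
    if "smooth_on U E" "x \<in> U" for x and E :: "real ^ 'm \<Rightarrow> 'f"
    using has_derivative_inner_right[OF has_derivative_partials[OF smooth_on_imp_differentiable[OF that]], of d]
    by (simp add: inner_sum_right)
  show ?thesis
    unfolding has_partials_def using *[OF assms] *[OF smooth_on_partial_deriv[OF assms]] by blast
qed

text \<open>\<open>christoffel\<close> differentiates entries of the metric, whereas smoothness is
  given for the matrix-valued map.\<close>

lemma partial_deriv_matrix_component:
  fixes G :: "real ^ 'm \<Rightarrow> real ^ 'a ^ 'b"
  assumes "G differentiable (at x)"
  shows "partial_deriv i (\<lambda>y. G y $ j $ l) x = partial_deriv i G x $ j $ l"
proof -
  have "(G has_derivative frechet_derivative G (at x)) (at x)"
    using assms frechet_derivative_works by blast
  then have "((\<lambda>y. G y $ j $ l) has_derivative (\<lambda>h. frechet_derivative G (at x) h $ j $ l)) (at x)"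
    by (intro bounded_linear.has_derivative[OF bounded_linear_vec_nth])
  from frechet_derivative_at[OF this] show ?thesis
    unfolding partial_deriv_def by (rule fun_cong[OF sym])
qed

section \<open>The tension field as an elliptic operator\<close>

lemma continuous_on_christoffel:
  fixes G :: "real ^ 'm \<Rightarrow> real ^ 'm ^ 'm"
  assumes G: "smooth_on U G" and pd: "\<And>x. x \<in> U \<Longrightarrow> pos_def (G x)"
  shows "continuous_on U (christoffel G k i j)"
proof -
  have inv: "continuous_on U (\<lambda>x. matrix_inv (G x) $ k $ l)" for l
    by (rule continuous_on_matrix_inv_component[OF smooth_on_imp_continuous_on[OF G] pd])
  have part: "continuous_on U (\<lambda>x. partial_deriv i G x $ j $ l)" for i j l
    by (intro continuous_on_component smooth_on_imp_continuous_on[OF smooth_on_partial_deriv[OF G]])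
  have "christoffel G k i j x = (1 / 2) * (\<Sum>l\<in>UNIV. matrix_inv (G x) $ k $ l *
       (partial_deriv i G x $ j $ l + partial_deriv j G x $ i $ l - partial_deriv l G x $ i $ j))"
    if "x \<in> U" for x
    unfolding christoffel_def
    by (simp add: partial_deriv_matrix_component[OF smooth_on_imp_differentiable[OF G that]])
  moreover have "continuous_on U (\<lambda>x. (1 / 2) * (\<Sum>l\<in>UNIV. matrix_inv (G x) $ k $ l *
       (partial_deriv i G x $ j $ l + partial_deriv j G x $ i $ l - partial_deriv l G x $ i $ j)))"
    by (intro continuous_on_mult continuous_on_sum continuous_on_const continuous_on_add
        continuous_on_diff inv part)
  ultimately show ?thesis
    by (subst continuous_on_cong[OF refl]) auto
qed

text \<open>This is the operator of the maximum principle: the inverse metric is the principal part,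
  the metric trace of the Christoffel symbols the drift.\<close>

lemma inner_tension_field:
  fixes F :: "real ^ 'm \<Rightarrow> 'f::real_inner"
  shows "d \<bullet> tension_field G F x =
    matrix_inv (G x) \<bullet> (\<chi> i j. d \<bullet> partial_deriv i (partial_deriv j F) x)
      - (\<chi> k. \<Sum>i\<in>UNIV. \<Sum>j\<in>UNIV. matrix_inv (G x) $ i $ j * christoffel G k i j x)
          \<bullet> (\<chi> k. d \<bullet> partial_deriv k F x)"
proof -
  have "(\<Sum>i\<in>UNIV. \<Sum>j\<in>UNIV. \<Sum>k\<in>UNIV.
        matrix_inv (G x) $ i $ j * christoffel G k i j x * (d \<bullet> partial_deriv k F x)) =
      (\<Sum>k\<in>UNIV. \<Sum>i\<in>UNIV. \<Sum>j\<in>UNIV.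
        matrix_inv (G x) $ i $ j * christoffel G k i j x * (d \<bullet> partial_deriv k F x))"
    by (rule trans[OF sum.cong[OF refl sum.swap] sum.swap])
  then show ?thesis
    by (simp add: tension_field_def nabla_d_def inner_vec_def inner_sum_right inner_diff_right
        right_diff_distrib sum_subtractf sum_distrib_left sum_distrib_right mult.assoc)
qed

section \<open>The maximum principle on the manifold\<close>

lemma smooth_map_continuous:
  assumes "smooth_atlas A" and "smooth_map A f"
  shows "continuous_on UNIV f"
proof -
  have "continuous_on (fst c) f" if c: "c \<in> A" for c
  proof -
    have hom: "homeomorphism (fst c) (snd c ` fst c) (snd c) (chart_inv c)"
      using assms(1) c by (auto simp: smooth_atlas_def)
    have "continuous_on (snd c ` fst c) (f \<circ> chart_inv c)"
      using assms(2) c by (intro smooth_on_imp_continuous_on) (simp add: smooth_map_def)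
    then have "continuous_on (fst c) ((f \<circ> chart_inv c) \<circ> snd c)"
      using hom by (intro continuous_on_compose[of "fst c" "snd c" "f \<circ> chart_inv c"])
        (auto simp: homeomorphism_def)
    then show ?thesis
      by (rule continuous_on_eq) (use hom in \<open>auto simp: homeomorphism_def\<close>)
  qed
  then have "continuous_on (\<Union>c\<in>A. fst c) f"
    using assms(1) by (intro continuous_on_open_UN) (auto simp: smooth_atlas_def)
  then show ?thesis
    using assms(1) by (simp add: smooth_atlas_def)
qed

lemma harmonic_map_strong_maximum:
  assumes man: "riemannian_manifold A g" and harm: "harmonic_map A g f"
    and W: "open W" "q \<in> W" and max: "\<And>x. x \<in> W \<Longrightarrow> d \<bullet> f x \<le> d \<bullet> f q"
  shows "\<exists>N. open N \<and> q \<in> N \<and> N \<subseteq> W \<and> (\<forall>x\<in>N. d \<bullet> f x = d \<bullet> f q)"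
proof -
  have atlas: "smooth_atlas A" and metric: "riemannian_metric A g"
    using man by (auto simp: riemannian_manifold_def)
  then obtain c where c: "c \<in> A" "q \<in> fst c"
    unfolding smooth_atlas_def by blast
  define V where "V = snd c ` fst c"
  have hom: "homeomorphism (fst c) V (snd c) (chart_inv c)" and V: "open V" "open (fst c)"
    using atlas c(1) by (auto simp: smooth_atlas_def V_def)
  have inv: "chart_inv c (snd c x) = x" if "x \<in> fst c" for x
    using hom that by (simp add: homeomorphism_def)
  \<comment> \<open>The coordinate image of the part of \<open>W\<close> inside the chart, where
    \<open>f q\<close> is maximal in direction \<open>d\<close>.\<close>
  define U where "U = V \<inter> chart_inv c -` W"
  have "open U"
    using hom V(1) W(1) unfolding U_def
    by (intro continuous_open_preimage) (auto simp: homeomorphism_def)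
  have UV: "U \<subseteq> V" by (auto simp: U_def)
  define F where "F = f \<circ> chart_inv c"
  define G where "G = g c"
  have "smooth_on V F"
    using harm c(1) by (simp add: harmonic_map_def smooth_map_def V_def F_def)
  note part = has_partials_subset[OF has_partials_inner_smooth[OF this] UV, of d]
  have G: "smooth_on V G" "\<And>x. x \<in> V \<Longrightarrow> transpose (G x) = G x" "\<And>x. x \<in> V \<Longrightarrow> pos_def (G x)"
    using metric c(1) unfolding riemannian_metric_def V_def G_def pos_def_def by blast+
  define a where "a x = matrix_inv (G x)" for x
  define b where "b x = (\<chi> k. \<Sum>i\<in>UNIV. \<Sum>j\<in>UNIV. a x $ i $ j * christoffel G k i j x)" for x
  have conta: "continuous_on V (\<lambda>x. a x $ i $ j)" for i j
    unfolding a_def by (rule continuous_on_matrix_inv_component[OF smooth_on_imp_continuous_on[OF G(1)] G(3)])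
  have "continuous_on V (\<lambda>x. (\<chi> i j. a x $ i $ j))"
    by (intro continuous_on_vec_lambda conta)
  then have "continuous_on V a" by simp
  moreover have "continuous_on V b"
    unfolding b_def
    by (intro continuous_on_vec_lambda continuous_on_sum continuous_on_mult conta
        continuous_on_christoffel[OF G(1,3)])
  ultimately have cont: "continuous_on U a" "continuous_on U b"
    using UV continuous_on_subset by blast+
  have "\<exists>e>0. ball (snd c q) e \<subseteq> U \<and> (\<forall>x\<in>ball (snd c q) e. d \<bullet> F x = d \<bullet> f q)"
  proof (rule strong_maximum_principle[OF \<open>open U\<close> part cont])
    fix x assume "x \<in> U"
    then have "x \<in> V" using UV by auto
    then show "transpose (a x) = a x" "pos_def (a x)"
      using symmetric_matrix_inv pos_def_inverse G by (auto simp: a_def)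
    \<comment> \<open>Harmonicity gives equality in the differential inequality.\<close>
    have "tension_field G F x = 0"
      using harm c(1) \<open>x \<in> V\<close> by (auto simp: harmonic_map_def V_def F_def G_def)
    then show "0 \<le> a x \<bullet> (\<chi> i j. d \<bullet> partial_deriv i (partial_deriv j F) x)
        - b x \<bullet> (\<chi> k. d \<bullet> partial_deriv k F x)"
      using inner_tension_field[of d G F x] by (simp add: a_def b_def)
    show "d \<bullet> F x \<le> d \<bullet> f q"
      using \<open>x \<in> U\<close> max by (simp add: F_def U_def)
  qed (use c(2) W(2) in \<open>auto simp: U_def V_def F_def inv\<close>)
  then obtain e where e: "e > 0" "ball (snd c q) e \<subseteq> U" "\<And>x. x \<in> ball (snd c q) e \<Longrightarrow> d \<bullet> F x = d \<bullet> f q"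
    by blast
  define N where "N = fst c \<inter> snd c -` ball (snd c q) e"
  have "open N"
    using hom V(2) unfolding N_def
    by (intro continuous_open_preimage) (auto simp: homeomorphism_def)
  moreover have "q \<in> N"
    using c(2) e(1) by (simp add: N_def)
  moreover have "N \<subseteq> W"
    using e(2) by (auto simp: N_def U_def inv subset_iff)
  moreover have "\<forall>x\<in>N. d \<bullet> f x = d \<bullet> f q"
  proof
    fix x assume "x \<in> N"
    then show "d \<bullet> f x = d \<bullet> f q"
      using e(3)[of "snd c x"] by (simp add: N_def F_def inv)
  qed
  ultimately show ?thesis by blast
qed

text \<open>This form serves twice: with the preimage of an enclosed region's closure as
  \<open>K\<close>, and with \<open>K = W = UNIV\<close>, where the condition on
  \<open>K - W\<close> is vacuous.\<close>

lemma harmonic_map_interior_max: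
  fixes A :: "('a::{t2_space,second_countable_topology}, 'm::finite) chart set"
  assumes man: "riemannian_manifold A g" and harm: "harmonic_map A g f"
    and conn: "connected (UNIV :: 'a set)" and K: "compact K" "q0 \<in> K"
    and W: "open W" "W \<subseteq> K" and bdry: "\<And>q. q \<in> K - W \<Longrightarrow> d \<bullet> f q < d \<bullet> f q0"
  shows "K = UNIV" and "d \<bullet> f p = d \<bullet> f q"
proof -
  have contf: "continuous_on UNIV (\<lambda>q. d \<bullet> f q)"
    using smooth_map_continuous[of A f] man harm
    unfolding riemannian_manifold_def harmonic_map_def
    by (intro continuous_on_inner continuous_on_const) blast
  obtain q1 where q1: "q1 \<in> K" "\<And>q. q \<in> K \<Longrightarrow> d \<bullet> f q \<le> d \<bullet> f q1"
    using continuous_attains_sup[OF K(1) _ continuous_on_subset[OF contf subset_UNIV]] K(2) by blast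
  define S where "S = {q \<in> K. d \<bullet> f q = d \<bullet> f q1}"
  have "S = K \<inter> {q. d \<bullet> f q = d \<bullet> f q1}"
    by (auto simp: S_def)
  then have "closed S"
    using compact_imp_closed[OF K(1)] closed_Collect_eq[OF contf continuous_on_const] by auto
  moreover have "\<exists>N. open N \<and> q \<in> N \<and> N \<subseteq> S" if q: "q \<in> S" for q
  proof -
    have eq: "d \<bullet> f q = d \<bullet> f q1" and "q \<in> K"
      using q by (simp_all add: S_def)
    \<comment> \<open>The maximum is at least the value at \<open>q0\<close>, which all points of
      \<open>K - W\<close> stay below. So \<open>q\<close> lies in the open set \<open>W\<close> and
      the local principle applies.\<close>
    have "\<not> d \<bullet> f q < d \<bullet> f q0"
      using q1(2)[OF K(2)] unfolding eq not_less .
    then have qW: "q \<in> W"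
      using bdry[of q] \<open>q \<in> K\<close> by blast
    have "d \<bullet> f x \<le> d \<bullet> f q" if "x \<in> W" for x
      unfolding eq using that W(2) by (blast intro: q1(2))
    from harmonic_map_strong_maximum[OF man harm W(1) qW this]
    obtain N where N: "open N" "q \<in> N" "N \<subseteq> W" "\<And>x. x \<in> N \<Longrightarrow> d \<bullet> f x = d \<bullet> f q"
      by blast
    have "N \<subseteq> S"
    proof
      fix x assume "x \<in> N"
      then have "d \<bullet> f x = d \<bullet> f q1" "x \<in> K"
        using N(3,4) W(2) unfolding eq by blast+
      then show "x \<in> S"
        by (simp add: S_def)
    qed
    with N show ?thesis by blast
  qed
  then have "open S"
    by (subst open_subopen) blast
  moreover have "q1 \<in> S"
    using q1(1) by (simp add: S_def)
  ultimately have "S = UNIV"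
    using conn unfolding connected_clopen by auto
  then have "x \<in> {q \<in> K. d \<bullet> f q = d \<bullet> f q1}" for x
    by (simp add: S_def[symmetric])
  then show "K = UNIV" "d \<bullet> f p = d \<bullet> f q"
    by (blast, metis (mono_tags, lifting) mem_Collect_eq)
qed

section \<open>Proper harmonic maps into a cone region\<close>

theorem theorem3p4:
  fixes C R :: "(real ^ 'n) set"
    and A :: "('a::{t2_space,second_countable_topology}, 'm::finite) chart set"
    and g :: "('a, 'm) metric_components"
    and f :: "'a \<Rightarrow> real ^ 'n"
  assumes "perturbed_cone C"
    and "cone_region C R"
    and "riemannian_manifold A g"
    and "connected (UNIV :: 'a set)"
    and "complete_riemannian A g"
    and "harmonic_map A g f"
    and "proper f"
    and "range f \<subseteq> R"
  shows "f constant_on UNIV"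
proof -
  note max = harmonic_map_interior_max[OF assms(3,6,4)]
  \<comment> \<open>Types are inhabited, so any point of the manifold can serve as base
    point.\<close>
  fix q0 :: 'a
  have fR: "f q \<in> R" for q
    using assms(8) by auto
  have R: "open R" "enclosing_property R"
    using assms(2) by (auto simp: cone_region_def enclosing_property_def)
  then obtain H where H: "affine_hyperplane H" "f q0 \<notin> H"
      "compact (closure (connected_component_set (R - H) (f q0)))"
    using fR[of q0] by (auto simp: enclosing_property_def)
  then obtain d0 b0 where db0: "H = {x. d0 \<bullet> x = b0}"
    by (auto simp: affine_hyperplane_def)
  \<comment> \<open>Changing the sign of the equation of \<open>H\<close> if necessary puts
    \<open>f q0\<close> on its upper side.\<close>
  obtain d b where db: "H = {x. d \<bullet> x = b}" "b < d \<bullet> f q0"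
  proof (cases "b0 < d0 \<bullet> f q0")
    case True
    then show ?thesis using that db0 by blast
  next
    case False
    then have "- b0 < - d0 \<bullet> f q0"
      using H(2) db0 by auto
    moreover have "H = {x. - d0 \<bullet> x = - b0}"
      using db0 by auto
    ultimately show ?thesis using that by blast
  qed
  define B where "B = connected_component_set (R - H) (f q0)"
  have "open (R - H)"
    using R(1) closed_hyperplane[of d b] db(1) by (simp add: open_Diff)
  then have "open B"
    unfolding B_def by (rule open_connected_component)
  have q0B: "f q0 \<in> B"
    using fR H(2) by (simp add: B_def)
  \<comment> \<open>A component is closed relative to \<open>R - H\<close>. Hence a limit point of
    \<open>B\<close> within \<open>R\<close> either belongs to \<open>B\<close> or lies on
    \<open>H\<close>.\<close>
  have closB: "x \<in> B" if "x \<in> closure B" "x \<in> R" "x \<notin> H" for x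
  proof -
    have "closedin (top_of_set (R - H)) B"
      unfolding B_def by (rule closedin_connected_component)
    then obtain T where "closed T" "B = (R - H) \<inter> T"
      by (auto simp: closedin_closed)
    then have "closure B \<subseteq> T"
      by (simp add: closure_minimal)
    then show ?thesis
      using that \<open>B = (R - H) \<inter> T\<close> by blast
  qed
  have contf: "continuous_on UNIV f"
    using smooth_map_continuous[of A f] assms(3,6)
    by (auto simp: riemannian_manifold_def harmonic_map_def)
  have "f -` closure B = UNIV"
  proof (rule max(1)[of "f -` closure B" q0 "f -` B" d])
    show "compact (f -` closure B)"
      using assms(7) H(3) by (simp add: proper_def B_def)
    show "open (f -` B)"
      using \<open>open B\<close> contf by (simp add: open_vimage)
    show "f -` B \<subseteq> f -` closure B"
      using closure_subset by blast
    show "q0 \<in> f -` closure B"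
      using q0B closure_subset by blast
    fix q assume "q \<in> f -` closure B - f -` B"
    then have "f q \<in> H"
      using closB fR by auto
    then show "d \<bullet> f q < d \<bullet> f q0"
      using db by simp
  qed
  then have "compact (UNIV :: 'a set)"
    using assms(7) H(3) by (metis B_def proper_def)
  \<comment> \<open>On the compact manifold every linear functional of \<open>f\<close> attains its
    maximum and is therefore constant; together they separate points.\<close>
  then have "\<forall>e. e \<bullet> f p = e \<bullet> f q" for p q
    by (intro allI max(2)[of UNIV q0 UNIV]) auto
  then have "f p = f q" for p q
    by (simp only: vector_eq_ldot)
  then show ?thesis
    unfolding constant_on_def by blast
qed

end
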